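(* For every integer $k\ge 1$, $$G_{2\text{-}1\text{-}3}^{12\ldots k}(x)=x^kC^{k+1}(x),$$ where $G_{2\text{-}1\text{-}3}^{12\ldots k}(x)$ is the ordinary generating function $\sum_{n\ge 1}N(n)x^n$, with $N(n)$ the number of permutations of $\{1,\dots,n\}$ that avoid the classical pattern $2\text{-}1\text{-}3$ and begin with the pattern $12\ldots k$.
   Context: A permutation $\pi=\pi_1\cdots\pi_n$ avoids the classical pattern $2\text{-}1\text{-}3$ if there are no indices $a<b<c$ with $\pi_b<\pi_a<\pi_c$. It begins with the pattern $12\ldots k$ if $n\ge k$ and $\pi_1<\pi_2<\cdots<\pi_k$. The empty permutation is not counted. $C(x)=\sum_{n\ge0}C_nx^n=\frac{1-\sqrt{1-4x}}{2x}$ is the generating function of the Catalan numbers $C_n$, and $C^j(x)=(C(x))^j$. *)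

theory Defs
  imports
    "HOL-Combinatorics.Multiset_Permutations"
    "HOL-Computational_Algebra.Formal_Power_Series"
begin

(* A permutation of {1..n} is the list of its values in one-line notation,
   an element of permutations_of_set {1..n}; list positions start at 0. *)

definition avoids_213 :: "nat list \<Rightarrow> bool" where
  "avoids_213 p \<longleftrightarrow>
     \<not> (\<exists>a b c. a < b \<and> b < c \<and> c < length p \<and> p ! b < p ! a \<and> p ! a < p ! c)"

definition begins_increasing :: "nat \<Rightarrow> nat list \<Rightarrow> bool" where
  "begins_increasing k p \<longleftrightarrow> k \<le> length p \<and> sorted_wrt (<) (take k p)"

definition num_avoiding_beginning :: "nat \<Rightarrow> nat \<Rightarrow> nat" where
  "num_avoiding_beginning k n =
     card {p \<in> permutations_of_set {1..n}. avoids_213 p \<and> begins_increasing k p}"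

(* The series starts at n = 1: the empty permutation is not counted. *)
definition G213 :: "nat \<Rightarrow> real fps" where
  "G213 k = Abs_fps (\<lambda>n. if n = 0 then 0 else of_nat (num_avoiding_beginning k n))"

(* The division is exact, see Suc_times_catalan. *)
definition catalan :: "nat \<Rightarrow> nat" where
  "catalan n = ((2 * n) choose n) div Suc n"

definition catalan_gf :: "real fps" where
  "catalan_gf = Abs_fps (\<lambda>n. of_nat (catalan n))"

lemma Suc_times_catalan: "Suc n * catalan n = (2 * n) choose n"
proof -
  have "Suc n * ((2 * n) choose Suc n) = (2 * n - n) * ((2 * n) choose n)"
    by (simp only: binomial_absorb_comp binomial_absorption)
  hence "Suc n * ((2 * n) choose n) - Suc n * ((2 * n) choose Suc n) = (2 * n) choose n"
    by simp
  hence "Suc n dvd ((2 * n) choose n)"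
    by (metis dvd_triv_left right_diff_distrib')
  thus ?thesis
    by (simp add: catalan_def del: mult_Suc)
qed

lemma central_binomial_Suc:
  "Suc n * ((2 * Suc n) choose Suc n) = 2 * (2 * n + 1) * ((2 * n) choose n)"
proof -
  have 1: "Suc n * ((2 * Suc n) choose Suc n) = 2 * Suc n * (Suc (2 * n) choose n)"
    using Suc_times_binomial_eq[of "Suc (2 * n)" n] by (simp add: mult_ac)
  have 2: "Suc n * (Suc (2 * n) choose n) = (2 * n + 1) * ((2 * n) choose n)"
    using binomial_absorb_comp[of "Suc (2 * n)" n] by simp
  show ?thesis
    using 1 2 by (metis mult.assoc)
qed

lemma half_gchoose_catalan:
  "((1 / 2 :: real) gchoose Suc n) * (- 4) ^ Suc n = - 2 * of_nat (catalan n)"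
proof -
  have cat: "of_nat (catalan n) = (of_nat ((2 * n) choose n) :: real) / of_nat (Suc n)" for n
    using arg_cong[OF Suc_times_catalan[of n], of "of_nat :: nat \<Rightarrow> real"]
    by (simp add: field_simps)
  have "((1 / 2 :: real) gchoose Suc n) * (- 4) ^ Suc n * of_nat (Suc n)
          = - 2 * of_nat ((2 * n) choose n)"
  proof (induction n)
    case 0
    show ?case by simp
  next
    case (Suc n)
    have g: "((1 / 2 :: real) gchoose Suc (Suc n)) * of_nat (Suc (Suc n))
               = ((1 / 2) gchoose Suc n) * (1 / 2 - of_nat (Suc n))"
      using gbinomial_mult_1[of "1 / 2 :: real" "Suc n"] by (simp add: algebra_simps)
    have c: "of_nat (Suc n) * (of_nat ((2 * Suc n) choose Suc n) :: real)
               = 2 * (2 * of_nat n + 1) * of_nat ((2 * n) choose n)"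
      using arg_cong[OF central_binomial_Suc[of n], of "of_nat :: nat \<Rightarrow> real"]
      by (simp only: of_nat_mult of_nat_add of_nat_numeral of_nat_1)
    have "((1 / 2 :: real) gchoose Suc (Suc n)) * (- 4) ^ Suc (Suc n) * of_nat (Suc (Suc n))
            * of_nat (Suc n)
          = (((1 / 2 :: real) gchoose Suc (Suc n)) * of_nat (Suc (Suc n)))
            * (- 4) * (- 4) ^ Suc n * of_nat (Suc n)"
      by (simp only: power_Suc mult_ac)
    also have "\<dots> = (((1 / 2 :: real) gchoose Suc n) * (- 4) ^ Suc n * of_nat (Suc n))
            * (2 * (2 * of_nat n + 1))"
      unfolding g by (simp add: algebra_simps)
    also have "\<dots> = - 2 * (of_nat (Suc n) * of_nat ((2 * Suc n) choose Suc n))"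
      unfolding Suc.IH c by (simp only: mult_ac)
    finally have "((1 / 2 :: real) gchoose Suc (Suc n)) * (- 4) ^ Suc (Suc n) * of_nat (Suc (Suc n))
            * of_nat (Suc n) = - 2 * of_nat ((2 * Suc n) choose Suc n) * of_nat (Suc n)"
      by (simp only: mult_ac)
    thus ?case
      by (rule mult_right_cancel[THEN iffD1, rotated]) (rule of_nat_neq_0)
  qed
  thus ?thesis
    unfolding cat by (simp add: field_simps)
qed

lemma catalan_gf_closed_form:
  "catalan_gf = (1 - fps_radical root 2 (1 - 4 * fps_X)) / (2 * fps_X)"
proof -
  define B :: "real fps" where "B = 1 - 2 * fps_X * catalan_gf"
  have "B = fps_binomial (1 / 2) oo (fps_const (- 4) * fps_X)"
  proof (rule fps_ext)
    fix n
    show "fps_nth B n = fps_nth (fps_binomial (1 / 2) oo (fps_const (- 4) * fps_X)) n"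
    proof (cases n)
      case 0
      thus ?thesis by (simp add: B_def fps_compose_linear)
    next
      case (Suc m)
      have "B = 1 - fps_X * (fps_const 2 * catalan_gf)"
        by (simp only: B_def numeral_fps_const mult_ac)
      hence "fps_nth B (Suc m) = - 2 * of_nat (catalan m)"
        by (simp add: catalan_gf_def)
      thus ?thesis
        using half_gchoose_catalan[of m] unfolding Suc fps_compose_linear
        by (simp add: mult.commute)
    qed
  qed
  hence "B ^ 2 = (fps_binomial (1 / 2) ^ 2) oo (fps_const (- 4) * fps_X)"
    by (simp add: fps_compose_power)
  also have "fps_binomial (1 / 2 :: real) ^ 2 = 1 + fps_X"
    by (simp add: fps_binomial_power fps_binomial_1)
  also have "(1 + fps_X) oo (fps_const (- 4 :: real) * fps_X) = 1 - 4 * fps_X"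
    by (simp add: fps_compose_add_distrib numeral_fps_const flip: fps_const_neg)
  finally have "B ^ Suc 1 = 1 - 4 * fps_X"
    by (simp add: numeral_2_eq_2)
  moreover have "fps_nth B 0 = 1"
    by (simp add: B_def)
  ultimately have B: "B = fps_radical root 2 (1 - 4 * fps_X)"
    using radical_unique[of root 1 "1 - 4 * fps_X" B] by (simp add: numeral_2_eq_2)
  have "1 - fps_radical root 2 (1 - 4 * fps_X) = catalan_gf * (2 * fps_X)"
    by (subst B [symmetric]) (simp add: B_def mult_ac)
  thus ?thesis
    by (simp only:) (rule nonzero_mult_div_cancel_right[symmetric], simp)
qed

end

theory Submission
  imports Defs
begin

text \<open>
  The theorem follows from splitting a permutation at its first entry.  If \<open>m # q\<close> avoids
  \<open>2-1-3\<close>, then no entry of \<open>q\<close> below \<open>m\<close> precedes an entry above \<open>m\<close>, since together with the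
  leading \<open>m\<close> they would form the pattern.  Hence \<open>q = a @ b\<close> with all of \<open>a\<close> above \<open>m\<close> and all
  of \<open>b\<close> below it.  Conversely \<open>a\<close> and \<open>b\<close> may be arbitrary avoiders: in an occurrence of the
  pattern the last entry is the largest, so an occurrence whose last entry lies in the low
  block \<open>b\<close> lies in \<open>b\<close> entirely, and one whose last entry lies in \<open>a\<close> lies in \<open>a\<close>, because
  \<open>m\<close> is smaller than everything in \<open>a\<close>.  An initial increasing run of \<open>m # a @ b\<close> cannot
  enter \<open>b\<close>, so \<open>m # a @ b\<close> begins with \<open>12...(k+1)\<close> iff \<open>a\<close> begins with \<open>12...k\<close>
  (\<open>avoiders_Suc\<close>).

  Write \<open>F k\<close> for the generating function of the avoiders beginning with \<open>12...k\<close>, where for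
  \<open>k = 0\<close> the empty permutation is included.  The decomposition gives
  \<open>F (k + 1) = x F k F 0\<close> for all \<open>k\<close>.  Since every nonempty permutation begins with the pattern
  \<open>1\<close>, also \<open>F 0 = 1 + F 1 = 1 + x (F 0)\<^sup>2\<close>.  This quadratic equation has only one power series
  solution, the Catalan series, so \<open>F 0 = C\<close> and \<open>F k = x\<^sup>k C\<^sup>k\<^sup>+\<^sup>1\<close> by induction.
\<close>

section \<open>Splitting a 2-1-3 avoiding word at its first entry\<close>

text \<open>
  The leading entry can only play the role of the 2, which turns the condition on triples of
  positions into a condition on pairs and makes avoidance accessible to list induction.
\<close>

lemma avoids_213_Cons:
  "avoids_213 (m # q) \<longleftrightarrow> avoids_213 q \<and> sorted_wrt (\<lambda>y z. \<not> (y < m \<and> m < z)) q"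
proof
  assume L: "avoids_213 (m # q)"
  have "avoids_213 q"
    unfolding avoids_213_def
  proof
    assume "\<exists>a b c. a < b \<and> b < c \<and> c < length q \<and> q ! b < q ! a \<and> q ! a < q ! c"
    then obtain a b c where
      "a < b \<and> b < c \<and> c < length q \<and> q ! b < q ! a \<and> q ! a < q ! c"
      by blast
    hence "Suc a < Suc b \<and> Suc b < Suc c \<and> Suc c < length (m # q)
        \<and> (m # q) ! Suc b < (m # q) ! Suc a \<and> (m # q) ! Suc a < (m # q) ! Suc c"
      by simp
    thus False using L unfolding avoids_213_def by blast
  qed
  moreover have "sorted_wrt (\<lambda>y z. \<not> (y < m \<and> m < z)) q"
    unfolding sorted_wrt_iff_nth_less
  proof (intro allI impI notI)
    fix i j assume "i < j" "j < length q" "q ! i < m \<and> m < q ! j"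
    hence "0 < Suc i \<and> Suc i < Suc j \<and> Suc j < length (m # q)
        \<and> (m # q) ! Suc i < (m # q) ! 0 \<and> (m # q) ! 0 < (m # q) ! Suc j"
      by simp
    thus False using L unfolding avoids_213_def by blast
  qed
  ultimately show "avoids_213 q \<and> sorted_wrt (\<lambda>y z. \<not> (y < m \<and> m < z)) q" ..
next
  assume R: "avoids_213 q \<and> sorted_wrt (\<lambda>y z. \<not> (y < m \<and> m < z)) q"
  show "avoids_213 (m # q)"
    unfolding avoids_213_def
  proof
    assume "\<exists>a b c. a < b \<and> b < c \<and> c < length (m # q)
        \<and> (m # q) ! b < (m # q) ! a \<and> (m # q) ! a < (m # q) ! c"
    then obtain a b c where abc: "a < b" "b < c" "c < length (m # q)"
      "(m # q) ! b < (m # q) ! a" "(m # q) ! a < (m # q) ! c"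
      by blast
    obtain b' c' where [simp]: "b = Suc b'" "c = Suc c'"
      using abc(1,2) by (metis less_nat_zero_code not0_implies_Suc)
    show False
    proof (cases a)
      case 0
      thus False using abc R by (auto simp: sorted_wrt_iff_nth_less)
    next
      case (Suc a')
      thus False using abc R by (auto simp: avoids_213_def)
    qed
  qed
qed

lemma avoids_213_Nil: "avoids_213 []"
  by (simp add: avoids_213_def)

lemma no_low_before_high_if_one_sided:
  fixes m :: nat
  assumes "(\<forall>x\<in>set q. m < x) \<or> (\<forall>x\<in>set q. x < m)"
  shows "sorted_wrt (\<lambda>y z. \<not> (y < m \<and> m < z)) q"
  using assms by (induction q) (auto dest: less_not_sym)

lemma avoids_213_append_high_low:
  assumes "\<forall>x\<in>set a. \<forall>y\<in>set b. y < x"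
  shows "avoids_213 (a @ b) \<longleftrightarrow> avoids_213 a \<and> avoids_213 b"
  using assms
proof (induction a)
  case Nil
  show ?case by (simp add: avoids_213_Nil)
next
  case (Cons m a)
  have "sorted_wrt (\<lambda>y z. \<not> (y < m \<and> m < z)) b"
    using Cons.prems by (intro no_low_before_high_if_one_sided) simp
  moreover have "\<forall>z\<in>set b. \<not> m < z"
    using Cons.prems by auto
  ultimately show ?case
    using Cons by (auto simp: avoids_213_Cons sorted_wrt_append)
qed

lemma avoids_213_first_high_low:
  assumes "\<forall>x\<in>set a. m < x" "\<forall>y\<in>set b. y < m"
  shows "avoids_213 (m # a @ b) \<longleftrightarrow> avoids_213 a \<and> avoids_213 b"
proof -
  have "sorted_wrt (\<lambda>y z. \<not> (y < m \<and> m < z)) a" "sorted_wrt (\<lambda>y z. \<not> (y < m \<and> m < z)) b"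
    using assms by (blast intro: no_low_before_high_if_one_sided)+
  hence "sorted_wrt (\<lambda>y z. \<not> (y < m \<and> m < z)) (a @ b)"
    using assms by (auto simp: sorted_wrt_append)
  moreover have "\<forall>x\<in>set a. \<forall>y\<in>set b. y < x"
    using assms less_trans by blast
  ultimately show ?thesis
    by (simp add: avoids_213_Cons avoids_213_append_high_low)
qed

lemma high_before_low_split:
  fixes q :: "nat list"
  assumes "sorted_wrt (\<lambda>y z. \<not> (y < m \<and> m < z)) q" "m \<notin> set q"
  shows "q = filter (\<lambda>x. m < x) q @ filter (\<lambda>x. x < m) q"
  using assms
proof (induction q)
  case (Cons y q)
  show ?case
  proof (cases "m < y")
    case False
    hence "y < m" using Cons.prems(2) by auto
    hence low: "\<forall>z\<in>set q. z < m"
      using Cons.prems by (auto simp: not_less le_less)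
    hence "filter (\<lambda>x. m < x) q = []" "filter (\<lambda>x. x < m) q = q"
      by (auto simp: filter_empty_conv filter_id_conv dest: less_not_sym)
    thus ?thesis using \<open>y < m\<close> False by simp
  qed (use Cons in auto)
qed simp

text \<open>
  The run of length \<open>k + 1\<close> must end within \<open>m # a\<close>: otherwise it would contain an entry of
  \<open>b\<close>, which is smaller than the first entry \<open>m\<close>.
\<close>

lemma begins_increasing_first_high_low:
  assumes "\<forall>x\<in>set a. m < x" "\<forall>y\<in>set b. y < m"
  shows "begins_increasing (Suc k) (m # a @ b) \<longleftrightarrow> begins_increasing k a"
proof (cases "k \<le> length a")
  case True
  have "\<forall>x\<in>set (take k a). m < x"
    using assms(1) by (auto dest: in_set_takeD)
  thus ?thesis
    using True by (simp add: begins_increasing_def)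
next
  case False
  have "\<not> begins_increasing (Suc k) (m # a @ b)"
  proof
    assume beg: "begins_increasing (Suc k) (m # a @ b)"
    then obtain y b' where [simp]: "b = y # b'"
      using False by (cases b) (auto simp: begins_increasing_def)
    have "y \<in> set (take k (a @ b))"
      using False by (cases "k - length a") auto
    hence "m < y"
      using beg by (simp add: begins_increasing_def del: take_append)
    thus False
      using assms(2) by auto
  qed
  thus ?thesis
    using False by (simp add: begins_increasing_def)
qed

section \<open>The recurrence for the numbers of avoiding permutations\<close>

text \<open>
  The high block of a permutation of \<open>{1..n}\<close> is an arrangement of \<open>{m + 1..n}\<close>, so the
  decomposition is stated for arrangements of arbitrary sets of values.
\<close>

definition avoiders :: "nat \<Rightarrow> nat set \<Rightarrow> nat list set" where
  "avoiders k S = {p \<in> permutations_of_set S. avoids_213 p \<and> begins_increasing k p}"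

lemma finite_avoiders: "finite (avoiders k S)"
  by (simp add: avoiders_def)

lemma begins_increasing_0: "begins_increasing 0 p"
  by (simp add: begins_increasing_def)

lemma avoiders_Suc:
  "avoiders (Suc k) S =
     (\<Union>m\<in>S. (\<lambda>(a, b). m # a @ b) ` (avoiders k {x\<in>S. m < x} \<times> avoiders 0 {x\<in>S. x < m}))"
proof (intro subset_antisym subsetI)
  fix p assume p: "p \<in> avoiders (Suc k) S"
  then obtain m q where pq: "p = m # q"
    by (cases p) (auto simp: avoiders_def begins_increasing_def)
  define a where "a = filter (\<lambda>x. m < x) q"
  define b where "b = filter (\<lambda>x. x < m) q"
  have S: "insert m (set q) = S" and "m \<notin> set q" "distinct q" "avoids_213 (m # q)"
    using p by (auto simp: avoiders_def permutations_of_set_def pq)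
  hence q: "q = a @ b"
    unfolding a_def b_def by (intro high_before_low_split) (simp_all add: avoids_213_Cons)
  have ab: "\<forall>x\<in>set a. m < x" "\<forall>y\<in>set b. y < m"
    by (auto simp: a_def b_def)
  have "a \<in> permutations_of_set {x\<in>S. m < x}" "b \<in> permutations_of_set {x\<in>S. x < m}"
    using \<open>distinct q\<close> S unfolding permutations_of_set_def a_def b_def by auto
  moreover have "avoids_213 a \<and> avoids_213 b" "begins_increasing k a"
    using p avoids_213_first_high_low[OF ab] begins_increasing_first_high_low[OF ab]
    by (auto simp: avoiders_def pq q)
  ultimately have "(a, b) \<in> avoiders k {x\<in>S. m < x} \<times> avoiders 0 {x\<in>S. x < m}"
    by (simp add: avoiders_def begins_increasing_0)
  moreover have "m \<in> S" using S by auto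
  ultimately show "p \<in> (\<Union>m\<in>S. (\<lambda>(a, b). m # a @ b) `
      (avoiders k {x\<in>S. m < x} \<times> avoiders 0 {x\<in>S. x < m}))"
    unfolding pq q by force
next
  fix p assume "p \<in> (\<Union>m\<in>S. (\<lambda>(a, b). m # a @ b) `
      (avoiders k {x\<in>S. m < x} \<times> avoiders 0 {x\<in>S. x < m}))"
  then obtain m a b where m: "m \<in> S" and p: "p = m # a @ b"
    and a: "a \<in> avoiders k {x\<in>S. m < x}" and b: "b \<in> avoiders 0 {x\<in>S. x < m}"
    by auto
  have sets: "set a = {x\<in>S. m < x}" "set b = {x\<in>S. x < m}" and "distinct a" "distinct b"
    using a b by (auto simp: avoiders_def permutations_of_set_def)
  hence ab: "\<forall>x\<in>set a. m < x" "\<forall>y\<in>set b. y < m"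
    by auto
  have "set p = insert m ({x\<in>S. m < x} \<union> {x\<in>S. x < m})"
    unfolding p by (simp add: sets)
  also have "\<dots> = S"
    using m by (auto simp: not_less le_less)
  finally have "set p = S" .
  moreover have "distinct p"
    unfolding p using \<open>distinct a\<close> \<open>distinct b\<close> by (auto simp: sets)
  moreover have "avoids_213 p" "begins_increasing (Suc k) p"
    using a b unfolding p avoids_213_first_high_low[OF ab] begins_increasing_first_high_low[OF ab]
    by (simp_all add: avoiders_def)
  ultimately show "p \<in> avoiders (Suc k) S"
    by (simp add: avoiders_def permutations_of_set_def)
qed

lemma card_avoiders_Suc:
  assumes "finite S"
  shows "card (avoiders (Suc k) S) =
           (\<Sum>m\<in>S. card (avoiders k {x\<in>S. m < x}) * card (avoiders 0 {x\<in>S. x < m}))"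
proof -
  \<comment> \<open>The place where the two blocks meet is determined by the number of entries above \<open>m\<close>.\<close>
  have len: "length a = card {x\<in>S. m < x}" if "a \<in> avoiders k {x\<in>S. m < x}" for a m
    using that length_finite_permutations_of_set by (auto simp: avoiders_def)
  have inj: "inj_on (\<lambda>(a, b). m # a @ b) (avoiders k {x\<in>S. m < x} \<times> avoiders 0 {x\<in>S. x < m})"
    for m
    by (auto simp: inj_on_def dest!: len)
  have "card (avoiders (Suc k) S) = (\<Sum>m\<in>S. card ((\<lambda>(a, b). m # a @ b) `
      (avoiders k {x\<in>S. m < x} \<times> avoiders 0 {x\<in>S. x < m})))"
    unfolding avoiders_Suc using assms
    by (intro card_UN_disjoint) (auto simp: finite_avoiders)
  thus ?thesis
    by (simp only: card_image[OF inj] card_cartesian_product)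
qed

lemma avoids_213_map_strict_mono:
  assumes "strict_mono f"
  shows "avoids_213 (map f p) \<longleftrightarrow> avoids_213 p"
proof -
  have "sorted_wrt (\<lambda>y z. \<not> (y < f m \<and> f m < z)) (map f q) \<longleftrightarrow>
        sorted_wrt (\<lambda>y z. \<not> (y < m \<and> m < z)) q" for m q
    by (simp add: sorted_wrt_map strict_mono_less[OF assms])
  thus ?thesis
    by (induction p) (simp_all add: avoids_213_Nil avoids_213_Cons)
qed

lemma begins_increasing_map_strict_mono:
  assumes "strict_mono f"
  shows "begins_increasing k (map f p) \<longleftrightarrow> begins_increasing k p"
  by (simp add: begins_increasing_def take_map sorted_wrt_map strict_mono_less[OF assms])

text \<open>
  Both conditions depend only on the relative order of the entries.  This lets the high block
  be shifted back to an initial segment.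
\<close>

lemma card_avoiders_image:
  assumes "strict_mono f"
  shows "card (avoiders k (f ` S)) = card (avoiders k S)"
proof -
  have "inj f"
    using assms by (rule strict_mono_imp_inj_on)
  hence "permutations_of_set (f ` S) = map f ` permutations_of_set S"
    by (intro permutations_of_set_image_inj) (rule inj_on_subset, auto)
  hence "avoiders k (f ` S) = map f ` avoiders k S"
    by (auto simp: avoiders_def avoids_213_map_strict_mono[OF assms]
        begins_increasing_map_strict_mono[OF assms])
  thus ?thesis
    using \<open>inj f\<close> by (simp add: card_image inj_on_subset[OF inj_mapI])
qed

lemma num_avoiding_beginning_eq_card_avoiders:
  "num_avoiding_beginning k n = card (avoiders k {1..n})"
  by (simp add: num_avoiding_beginning_def avoiders_def)

lemma num_avoiding_beginning_Suc_Suc: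
  "num_avoiding_beginning (Suc k) (Suc n) =
     (\<Sum>i=0..n. num_avoiding_beginning k i * num_avoiding_beginning 0 (n - i))"
proof -
  have "num_avoiding_beginning (Suc k) (Suc n) =
    (\<Sum>m\<in>{1..Suc n}. card (avoiders k {x\<in>{1..Suc n}. m < x}) *
                      card (avoiders 0 {x\<in>{1..Suc n}. x < m}))"
    unfolding num_avoiding_beginning_eq_card_avoiders by (rule card_avoiders_Suc) simp
  also have "\<dots> = (\<Sum>m\<in>{1..Suc n}. num_avoiding_beginning k (Suc n - m) *
                                      num_avoiding_beginning 0 (m - 1))"
  proof (rule sum.cong[OF refl])
    fix m assume m: "m \<in> {1..Suc n}"
    have "{x\<in>{1..Suc n}. m < x} = {1 + m..(Suc n - m) + m}"
      using m by auto
    also have "\<dots> = (+) m ` {1..Suc n - m}"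
      by (simp only: image_add_atLeastAtMost add.commute)
    finally have high: "{x\<in>{1..Suc n}. m < x} = (+) m ` {1..Suc n - m}" .
    have low: "{x\<in>{1..Suc n}. x < m} = {1..m - 1}"
      using m by auto
    have mono: "strict_mono ((+) m)"
      by (simp add: strict_mono_def)
    show "card (avoiders k {x\<in>{1..Suc n}. m < x}) * card (avoiders 0 {x\<in>{1..Suc n}. x < m}) =
        num_avoiding_beginning k (Suc n - m) * num_avoiding_beginning 0 (m - 1)"
      unfolding high low card_avoiders_image[OF mono] num_avoiding_beginning_eq_card_avoiders ..
  qed
  \<comment> \<open>Count by the number \<open>i\<close> of entries above the first one instead of by its value \<open>m\<close>.\<close>
  also have "\<dots> = (\<Sum>i=0..n. num_avoiding_beginning k i * num_avoiding_beginning 0 (n - i))"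
    by (rule sum.reindex_bij_witness[of _ "\<lambda>i. Suc n - i" "\<lambda>m. Suc n - m"]) auto
  finally show ?thesis .
qed

section \<open>Generating functions\<close>

definition avoider_gf :: "nat \<Rightarrow> real fps" where
  "avoider_gf k = Abs_fps (\<lambda>n. of_nat (num_avoiding_beginning k n))"

lemma num_avoiding_beginning_Suc_0: "num_avoiding_beginning (Suc k) 0 = 0"
  by (auto simp: num_avoiding_beginning_def begins_increasing_def)

lemma avoider_gf_Suc: "avoider_gf (Suc k) = fps_X * (avoider_gf k * avoider_gf 0)"
proof (rule fps_ext)
  fix n
  show "fps_nth (avoider_gf (Suc k)) n = fps_nth (fps_X * (avoider_gf k * avoider_gf 0)) n"
  proof (cases n)
    case (Suc j)
    have "fps_nth (avoider_gf k * avoider_gf 0) j =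
        of_nat (num_avoiding_beginning (Suc k) (Suc j))"
      by (simp add: avoider_gf_def num_avoiding_beginning_Suc_Suc fps_mult_nth)
    thus ?thesis
      by (simp add: Suc avoider_gf_def)
  qed (simp add: avoider_gf_def num_avoiding_beginning_Suc_0)
qed

lemma G213_eq_avoider_gf: "G213 (Suc k) = avoider_gf (Suc k)"
  by (rule fps_ext) (simp add: G213_def avoider_gf_def num_avoiding_beginning_Suc_0)

lemma avoider_gf_0: "avoider_gf 0 = 1 + fps_X * avoider_gf 0 ^ 2"
proof -
  have "avoider_gf 0 = 1 + avoider_gf (Suc 0)"
  proof (rule fps_ext)
    fix n
    show "fps_nth (avoider_gf 0) n = fps_nth (1 + avoider_gf (Suc 0)) n"
    proof (cases n)
      case 0
      have "{p \<in> permutations_of_set {1..0}. avoids_213 p \<and> begins_increasing 0 p} = {[]}"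
        by (auto simp: avoids_213_Nil begins_increasing_0)
      hence "num_avoiding_beginning 0 0 = 1"
        by (simp only: num_avoiding_beginning_def card_1_singleton_iff) simp
      thus ?thesis
        using 0 by (simp add: avoider_gf_def num_avoiding_beginning_Suc_0)
    next
      case (Suc m)
      \<comment> \<open>Every nonempty word begins with the pattern \<open>1\<close>.\<close>
      have "begins_increasing (Suc 0) p" if "p \<in> permutations_of_set {1..n}" for p
        using that Suc length_finite_permutations_of_set[OF that]
        by (cases p) (simp_all add: begins_increasing_def)
      hence "num_avoiding_beginning (Suc 0) n = num_avoiding_beginning 0 n"
        unfolding num_avoiding_beginning_def
        by (intro arg_cong[of _ _ card]) (auto simp: begins_increasing_0)
      thus ?thesis
        using Suc by (simp add: avoider_gf_def)
    qed
  qed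
  also have "\<dots> = 1 + fps_X * avoider_gf 0 ^ 2"
    by (simp only: avoider_gf_Suc power2_eq_square)
  finally show ?thesis .
qed

text \<open>
  The closed form says that \<open>1 - 2xC\<close> is the square root of \<open>1 - 4x\<close>; squaring this and
  cancelling \<open>4x\<close> gives the quadratic equation.
\<close>

lemma catalan_gf_quadratic: "catalan_gf = 1 + fps_X * catalan_gf ^ 2"
proof -
  define R :: "real fps" where "R = fps_radical root 2 (1 - 4 * fps_X)"
  have R0: "fps_nth R 0 = 1"
    by (simp add: R_def)
  have R2: "R ^ 2 = 1 - 4 * fps_X"
    using power_radical[of "1 - 4 * fps_X :: real fps" root 1]
    by (simp add: R_def numeral_2_eq_2)
  have "catalan_gf = (1 - R) / (2 * fps_X)"
    by (simp add: R_def catalan_gf_closed_form)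
  moreover have "(2 * fps_X :: real fps) dvd 1 - R"
  proof -
    have "1 - R = fps_X * fps_shift 1 (1 - R)"
      by (rule fps_ext) (simp add: R0)
    also have "\<dots> = (2 * fps_X) * (fps_const (1 / 2) * fps_shift 1 (1 - R))"
      by (rule fps_ext) (simp add: numeral_fps_const mult.assoc)
    finally show ?thesis by (rule dvdI)
  qed
  ultimately have "1 - R = 2 * fps_X * catalan_gf"
    by (metis dvd_mult_div_cancel)
  hence "R = 1 - 2 * fps_X * catalan_gf"
    by (metis diff_diff_eq2 add_diff_cancel_left')
  hence "(1 - 2 * fps_X * catalan_gf) ^ 2 = 1 - 4 * fps_X"
    using R2 by simp
  moreover have "(1 - 2 * fps_X * catalan_gf) ^ 2 =
      1 - 4 * fps_X * catalan_gf + 4 * fps_X * (fps_X * catalan_gf ^ 2)"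
    by (simp add: power2_eq_square algebra_simps)
  ultimately have "4 * fps_X * catalan_gf = 4 * fps_X * (1 + fps_X * catalan_gf ^ 2)"
    by algebra
  thus ?thesis
    by (simp only: mult_cancel_left) simp
qed

text \<open>
  Two solutions satisfy \<open>(F - G) (1 - x (F + G)) = 0\<close>, and the second factor has constant
  term 1.
\<close>

lemma catalan_equation_unique:
  fixes F G :: "'a :: idom fps"
  assumes F: "F = 1 + fps_X * F ^ 2" and G: "G = 1 + fps_X * G ^ 2"
  shows "F = G"
proof -
  have "(F - G) * (1 - fps_X * (F + G)) = (F - fps_X * F ^ 2) - (G - fps_X * G ^ 2)"
    by (simp add: power2_eq_square algebra_simps)
  also have "F - fps_X * F ^ 2 = 1"
    using F by (simp only: diff_eq_eq)
  also have "G - fps_X * G ^ 2 = 1"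
    using G by (simp only: diff_eq_eq)
  finally have "(F - G) * (1 - fps_X * (F + G)) = 0"
    by simp
  moreover have "fps_nth (1 - fps_X * (F + G)) 0 \<noteq> 0"
    by simp
  hence "1 - fps_X * (F + G) \<noteq> 0"
    by (metis fps_zero_nth)
  ultimately show ?thesis
    by simp
qed

lemma avoider_gf_0_eq: "avoider_gf 0 = catalan_gf"
  using avoider_gf_0 catalan_gf_quadratic by (rule catalan_equation_unique)

lemma avoider_gf_eq: "avoider_gf k = fps_X ^ k * catalan_gf ^ (k + 1)"
proof (induction k)
  case 0
  show ?case
    by (simp add: avoider_gf_0_eq)
next
  case (Suc k)
  show ?case
    unfolding avoider_gf_Suc Suc.IH avoider_gf_0_eq by (simp only: power_Suc add_Suc mult_ac)
qed

theorem proposition6: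
  fixes k :: nat
  assumes "k \<ge> 1"
  shows "G213 k = fps_X ^ k * catalan_gf ^ (k + 1)"
proof -
  obtain j where "k = Suc j"
    using assms by (cases k) auto
  thus ?thesis
    by (simp only: G213_eq_avoider_gf avoider_gf_eq)
qed

end
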